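(* Let $B$ be a (ordered) read-once branching program of width $3$ and length $n$, and let $\varepsilon>0$. Let $\mathcal{D}_{1/2}$ be an $(\varepsilon/n)^{10}$-biased distribution over subsets of $[n]$ with marginals $1/2$, and let $T\sim\mathcal{D}_{1/2}$. Let $B^T$ be the branching program obtained from $B$ by relabeling the layers of edges indexed by $[n]\setminus T$ so that these layers are locally monotone. Then for all $x$, $$\mathsf{Bias}_T(B)(x)=\mathsf{Bias}_T(B^T)(x)=\mathbb{E}_{y\sim U_{[n]\setminus T}}[B^T_{T|y}(x)],$$ and with probability at least $1-\varepsilon$ over the choice of $T$ and of $y\sim U_{[n]\setminus T}$, the function $B^T_{T|y}$ can be computed by a branching program of the form $D_1\circ\cdots\circ D_m$, where $D_1,\dots,D_m$ are defined over pairwise disjoint sets of at most $b=3\log(n/\varepsilon)$ variables and each $D_i$ is a width-$3$ read-once branching program with at most $2$ vertices in its first and in its last layer.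
   Context: A read-once branching program (ROBP) of width $w$ and length $n$ is a layered directed graph with layers $V_1,\dots,V_{n+1}$, $V_1$ a single start vertex, other layers of at most $w$ vertices, each vertex of $V_i$ having two outgoing edges into $V_{i+1}$ labeled $1$ and $-1$ (the $i$-th layer of edges), vertices of $V_{n+1}$ labeled accept/reject; on input $x$, step $i$ follows the edge labeled $x_i$; output $-1$ on acceptance, $1$ otherwise. A relabeling swaps, for some vertices, the labels of their two outgoing edges. For a vertex $v$ let $\beta_v$ be the acceptance probability starting from $v$ on uniformly random remaining input; order vertices of each layer by $\beta_v$ (ties broken arbitrarily but fixed); a layer is locally monotone if from each vertex $v$ in it the $1$-edge leads to a vertex of index at least that of the vertex reached by the $(-1)$-edge. A distribution $\mathcal{D}_p$ over subsets of $[n]$ is $\delta$-biased with marginals $p$ if $\Pr_{T\sim\mathcal{D}_p}[S\subseteq T]=p^{|S|}\pm\delta$ for every nonempty $S\subseteq[n]$. For $T\subseteq[n]$, $x\in\{\pm1\}^T$, $y\in\{\pm1\}^{[n]\setminus T}$, $\mathrm{Sel}_T(x,y)$ agrees with $x$ on $T$ and $y$ elsewhere; $f_{T|y}(x)=f(\mathrm{Sel}_T(x,y))$ and $\mathsf{Bias}_T(f)(x)=\mathbb{E}_{y\sim U_{[n]\setminus T}}[f_{T|y}(x)]$, $U_A$ uniform on $\{\pm1\}^A$. For programs $B_1,B_2$ on disjoint variables with the width of the last layer of $B_1$ equal to that of the first layer of $B_2$, $B_1\circ B_2$ is their concatenation.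
   Formalization: The probability claim excludes n = 1 with 9/10 < ε < 1, where it can fail (e.g. ε = 0.95, T = [1] always, B computing x_1, since then b < 1); log is taken to base 2 and n ≥ 1. *)

theory Defs
  imports "HOL-Probability.Probability"
begin

(* Everything is indexed from 0: [n] is {..<n}, the vertex layers are 0, ..., n, and edge
   layer i leads from vertex layer i to vertex layer i + 1.  The vertices of layer i are
   0, ..., width i - 1, so that equal widths identify the vertices of two layers
   canonically, as concatenation requires. *)

record bp =
  vars :: "nat list"                     (* vars ! i is the variable read by edge layer i *)
  width :: "nat \<Rightarrow> nat"
  edge :: "nat \<Rightarrow> nat \<Rightarrow> int \<Rightarrow> nat"  (* edge layer, source vertex, label 1 or -1 *)
  accepting :: "nat set"

abbreviation bp_length :: "bp \<Rightarrow> nat" where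
  "bp_length P \<equiv> length (vars P)"

(* A read-once program over the variable set set (vars P), which it reads in increasing
   order.  The first layer may have several vertices: the blocks of a concatenation are
   such programs. *)
definition read_once_bp :: "nat \<Rightarrow> bp \<Rightarrow> bool" where
  "read_once_bp w P \<longleftrightarrow>
     sorted_wrt (<) (vars P) \<and>
     (\<forall>i \<le> bp_length P. width P i \<le> w) \<and>
     (\<forall>i < bp_length P. \<forall>v < width P i. \<forall>b \<in> {-1, 1}. edge P i v b < width P (Suc i))"

definition robp :: "nat \<Rightarrow> nat \<Rightarrow> bp \<Rightarrow> bool" where
  "robp w n B \<longleftrightarrow> read_once_bp w B \<and> vars B = [0..<n] \<and> width B 0 = 1"

(* The vertex reached from vertex v of layer i after k steps on input x. *)
primrec walk :: "bp \<Rightarrow> (nat \<Rightarrow> int) \<Rightarrow> nat \<Rightarrow> nat \<Rightarrow> nat \<Rightarrow> nat" where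
  "walk P x i v 0 = v"
| "walk P x i v (Suc k) = edge P (i + k) (walk P x i v k) (x (vars P ! (i + k)))"

definition accepts_from :: "bp \<Rightarrow> nat \<Rightarrow> nat \<Rightarrow> (nat \<Rightarrow> int) \<Rightarrow> bool" where
  "accepts_from P i v x \<longleftrightarrow> walk P x i v (bp_length P - i) \<in> accepting P"

definition bp_eval :: "bp \<Rightarrow> (nat \<Rightarrow> int) \<Rightarrow> real" where
  "bp_eval P x = (if accepts_from P 0 0 x then -1 else 1)"

definition cube :: "nat set \<Rightarrow> (nat \<Rightarrow> int) set" where
  "cube A = A \<rightarrow>\<^sub>E {-1, 1}"

definition unif :: "nat set \<Rightarrow> (nat \<Rightarrow> int) pmf" where
  "unif A = pmf_of_set (cube A)"

definition accept_prob :: "bp \<Rightarrow> nat \<Rightarrow> nat \<Rightarrow> real" where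
  "accept_prob P i v =
     measure_pmf.prob (unif (set (drop i (vars P)))) {y. accepts_from P i v y}"

(* rk i v is the index of vertex v when layer i is ordered by acceptance probability;
   different rk correspond to different ways of breaking ties. *)
definition vertex_order :: "bp \<Rightarrow> (nat \<Rightarrow> nat \<Rightarrow> nat) \<Rightarrow> bool" where
  "vertex_order P rk \<longleftrightarrow>
     (\<forall>i \<le> bp_length P.
        bij_betw (rk i) {..<width P i} {..<width P i} \<and>
        (\<forall>u < width P i. \<forall>v < width P i.
           accept_prob P i u < accept_prob P i v \<longrightarrow> rk i u < rk i v))"

definition locally_monotone :: "(nat \<Rightarrow> nat \<Rightarrow> nat) \<Rightarrow> bp \<Rightarrow> nat \<Rightarrow> bool" where
  "locally_monotone rk P i \<longleftrightarrow>
     (\<forall>v < width P i. rk (Suc i) (edge P i v (-1)) \<le> rk (Suc i) (edge P i v 1))"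

definition relabeling :: "nat set \<Rightarrow> bp \<Rightarrow> bp \<Rightarrow> bool" where
  "relabeling A P Q \<longleftrightarrow>
     vars Q = vars P \<and> width Q = width P \<and> accepting Q = accepting P \<and>
     (\<forall>i < bp_length P. \<forall>v < width P i.
        (\<forall>b \<in> {-1, 1}. edge Q i v b = edge P i v b) \<or>
        (i \<in> A \<and> (\<forall>b \<in> {-1, 1}. edge Q i v b = edge P i v (- b))))"

(* "The program obtained from B by relabeling the edge layers in [n] - T so that they are
   locally monotone".  Relabeling changes no acceptance probability, so an order rk of the
   vertices of B is also one for C; it determines C on all vertices of the program. *)
definition monotone_relabeling ::
  "(nat \<Rightarrow> nat \<Rightarrow> nat) \<Rightarrow> nat \<Rightarrow> nat set \<Rightarrow> bp \<Rightarrow> bp \<Rightarrow> bool" where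
  "monotone_relabeling rk n T B C \<longleftrightarrow>
     relabeling ({..<n} - T) B C \<and> (\<forall>i \<in> {..<n} - T. locally_monotone rk C i)"

lemma monotone_relabeling_exists: "\<exists>C. monotone_relabeling rk n T B C"
proof -
  define C where "C = B\<lparr>edge := \<lambda>i v b.
    if i \<in> {..<n} - T \<and> rk (Suc i) (edge B i v 1) < rk (Suc i) (edge B i v (-1))
    then edge B i v (- b) else edge B i v b\<rparr>"
  have "monotone_relabeling rk n T B C"
    by (auto simp: monotone_relabeling_def relabeling_def locally_monotone_def C_def)
  then show ?thesis by blast
qed

(* Pitfall: for n = 1 and eps close to 1, an (eps/n)^10-biased distribution with marginals
   1/2 may put all its mass on T = {0}, while 3 log (n/eps) < 1 allows the blocks no
   variable at all; hence the treatment of n = 1, 9/10 < eps < 1 in the theorem. *)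
definition biased_subset_distr :: "nat \<Rightarrow> real \<Rightarrow> real \<Rightarrow> nat set pmf \<Rightarrow> bool" where
  "biased_subset_distr n \<delta> p D \<longleftrightarrow>
     set_pmf D \<subseteq> Pow {..<n} \<and>
     (\<forall>S. S \<subseteq> {..<n} \<and> S \<noteq> {} \<longrightarrow>
        \<bar>measure_pmf.prob D {T. S \<subseteq> T} - p ^ card S\<bar> \<le> \<delta>)"

definition Sel :: "nat set \<Rightarrow> (nat \<Rightarrow> int) \<Rightarrow> (nat \<Rightarrow> int) \<Rightarrow> (nat \<Rightarrow> int)" where
  "Sel T x y = (\<lambda>i. if i \<in> T then x i else y i)"

definition restrict_fun ::
  "((nat \<Rightarrow> int) \<Rightarrow> real) \<Rightarrow> nat set \<Rightarrow> (nat \<Rightarrow> int) \<Rightarrow> ((nat \<Rightarrow> int) \<Rightarrow> real)" where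
  "restrict_fun f T y = (\<lambda>x. f (Sel T x y))"

definition Bias ::
  "nat \<Rightarrow> nat set \<Rightarrow> ((nat \<Rightarrow> int) \<Rightarrow> real) \<Rightarrow> ((nat \<Rightarrow> int) \<Rightarrow> real)" where
  "Bias n T f = (\<lambda>x. measure_pmf.expectation (unif ({..<n} - T)) (\<lambda>y. restrict_fun f T y x))"

definition restriction_distr :: "nat \<Rightarrow> nat set pmf \<Rightarrow> (nat set \<times> (nat \<Rightarrow> int)) pmf" where
  "restriction_distr n D = do { T \<leftarrow> D; y \<leftarrow> unif ({..<n} - T); return_pmf (T, y) }"

definition bp_comp :: "bp \<Rightarrow> bp \<Rightarrow> bp" (infixr "\<circ>\<^sub>B" 65) where
  "P \<circ>\<^sub>B Q =
     \<lparr> vars = vars P @ vars Q,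
       width = (\<lambda>i. if i < bp_length P then width P i else width Q (i - bp_length P)),
       edge = (\<lambda>i. if i < bp_length P then edge P i else edge Q (i - bp_length P)),
       accepting = accepting Q \<rparr>"

fun bp_comp_list :: "bp list \<Rightarrow> bp" where
  "bp_comp_list [] = undefined"
| "bp_comp_list [P] = P"
| "bp_comp_list (P # Q # Ps) = P \<circ>\<^sub>B bp_comp_list (Q # Ps)"

definition composable :: "bp list \<Rightarrow> bool" where
  "composable Ps \<longleftrightarrow>
     Ps \<noteq> [] \<and>
     (\<forall>i. Suc i < length Ps \<longrightarrow>
        width (Ps ! i) (bp_length (Ps ! i)) = width (Ps ! Suc i) 0) \<and>
     (\<forall>j < length Ps. \<forall>i < j. set (vars (Ps ! i)) \<inter> set (vars (Ps ! j)) = {})"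

(* "f : {-1,1}^T -> {-1,1} is computed by some D_1 o ... o D_m, with the D_i width-w
   programs over disjoint sets of at most b variables and with at most 2 vertices in their
   first and last layers".  The concatenation is a branching program, so it has a
   single start vertex, and it may only read the variables in T. *)
definition computed_by_blocks ::
  "nat \<Rightarrow> real \<Rightarrow> nat set \<Rightarrow> ((nat \<Rightarrow> int) \<Rightarrow> real) \<Rightarrow> bool" where
  "computed_by_blocks w b T f \<longleftrightarrow>
     (\<exists>Ds. composable Ds \<and> width (hd Ds) 0 = 1 \<and>
        (\<forall>D \<in> set Ds.
           read_once_bp w D \<and> set (vars D) \<subseteq> T \<and> real (card (set (vars D))) \<le> b \<and>
           width D 0 \<le> 2 \<and> width D (bp_length D) \<le> 2) \<and>
        (\<forall>x \<in> cube T. f x = bp_eval (bp_comp_list Ds) x))"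

end

theory Submission imports Defs begin

text \<open>A locally monotone layer of width 3 either ignores its bit or has a label whose edges reach
  at most two vertices: two permutations that are comparable pointwise in the vertex order
  coincide.  So a layer that matters is left free with probability 1/2, collapses with
  probability 1/4 and is fixed without collapsing with probability 1/4, and the program can be
  cut at every collapse.  The number of free layers before the next collapse exceeds r with
  probability at most (2/3)^r.  Over a window of O(log (n/eps)) layers, small bias changes such
  probabilities only negligibly, while a longer window contains a collapse with
  high probability; a union bound over the starting layers concludes.\<close>


subsection \<open>Relabeling and bias\<close>

lemma finite_cube [simp]: "finite A \<Longrightarrow> finite (cube A)"
  by (simp add: cube_def finite_PiE)

lemma cube_nonempty [simp]: "cube A \<noteq> {}"
  by (simp add: cube_def PiE_eq_empty_iff)

lemma cube_apply: "x \<in> cube A \<Longrightarrow> i \<in> A \<Longrightarrow> x i \<in> {-1, 1}"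
  unfolding cube_def by (rule PiE_mem)

lemma Sel_mem: "\<lbrakk>x \<in> cube T; y \<in> cube (A - T); i \<in> A\<rbrakk> \<Longrightarrow> Sel T x y i \<in> {-1, 1}"
  using cube_apply[of x T i] cube_apply[of y "A - T" i] by (auto simp: Sel_def)

lemma walk_less_width:
  assumes "robp w n B" "\<And>i. i < n \<Longrightarrow> z i \<in> {-1, 1}" "j \<le> n"
  shows "walk B z 0 0 j < width B j"
  using assms(3)
proof (induction j)
  case 0
  then show ?case using assms(1) by (simp add: robp_def)
next
  case (Suc j)
  then show ?case
    using assms(1) assms(2)[of j] by (force simp: robp_def read_once_bp_def)
qed

lemma walk_Suc_shift:
  "walk P x i v (Suc k) = walk P x (Suc i) (edge P i v (x (vars P ! i))) k"
  by (induction k) simp_all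

lemma accepts_from_step:
  assumes "i < bp_length P"
  shows "accepts_from P i v x \<longleftrightarrow> accepts_from P (Suc i) (edge P i v (x (vars P ! i))) x"
proof -
  have "bp_length P - i = Suc (bp_length P - Suc i)" using assms by simp
  then show ?thesis unfolding accepts_from_def by (simp only: walk_Suc_shift)
qed

lemma relabeling_robp:
  assumes "relabeling A B C" "robp w n B"
  shows "robp w n C"
proof -
  have "edge C i v b < width C (Suc i)"
    if "i < bp_length C" "v < width C i" "b \<in> {-1, 1}" for i v b
  proof -
    have "(\<forall>b \<in> {-1, 1}. edge C i v b = edge B i v b) \<or>
          (\<forall>b \<in> {-1, 1}. edge C i v b = edge B i v (- b))"
      using assms(1) that by (auto simp: relabeling_def)
    then have "edge C i v b \<in> edge B i v ` {-1, 1}" using that(3) by auto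
    then show ?thesis using assms that by (auto simp: relabeling_def robp_def read_once_bp_def)
  qed
  then show ?thesis
    using assms by (auto simp: relabeling_def robp_def read_once_bp_def)
qed

text \<open>Flipping y at the layers where the walk of B meets a swapped vertex is a bijection
  of the cube, and the relabeled program follows on the flipped input the walk of B.\<close>

lemma Bias_relabeling:
  assumes B: "robp w n B" and C: "relabeling ({..<n} - T) B C" and x: "x \<in> cube T"
  shows "Bias n T (bp_eval B) x = Bias n T (bp_eval C) x"
proof -
  let ?A = "{..<n} - T"
  define sw where "sw i v \<longleftrightarrow> \<not> (\<forall>b \<in> {-1, 1}. edge C i v b = edge B i v b)" for i v
  define W where "W y i = walk B (Sel T x y) 0 0 i" for y i
  define \<phi> where "\<phi> y = (\<lambda>i. if i \<in> ?A then if sw i (W y i) then - y i else y i else undefined)"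
    for y :: "nat \<Rightarrow> int"
  have CB: "vars C = [0..<n]" "vars B = [0..<n]" "accepting C = accepting B"
    using B C by (auto simp: robp_def relabeling_def)
  have sw: "i \<in> ?A \<and> (\<forall>b \<in> {-1, 1}. edge C i v b = edge B i v (- b))"
    if "sw i v" "i < n" "v < width B i" for i v
    using C that CB by (auto simp: relabeling_def sw_def)
  have \<phi>_cube: "\<phi> y \<in> cube ?A" if "y \<in> cube ?A" for y
    using cube_apply[OF that] unfolding cube_def \<phi>_def by (intro PiE_I) auto
  have walk_eq: "walk C (Sel T x (\<phi> y)) 0 0 i = W y i" if y: "y \<in> cube ?A" and "i \<le> n" for y i
    using that(2)
  proof (induction i)
    case 0
    then show ?case by (simp add: W_def)
  next
    case (Suc i)
    then have i: "i < n" by simp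
    have z: "Sel T x y i \<in> {-1, 1}" using Sel_mem[OF x y] i by simp
    have w: "W y i < width B i"
      unfolding W_def using walk_less_width[OF B, of "Sel T x y" i] Sel_mem[OF x y] i by simp
    have "edge C i (W y i) (Sel T x (\<phi> y) i) = edge B i (W y i) (Sel T x y i)"
    proof (cases "sw i (W y i)")
      case True
      from sw[OF this i w] show ?thesis using z True by (auto simp: Sel_def \<phi>_def)
    next
      case False
      then have "Sel T x (\<phi> y) i = Sel T x y i" using i by (auto simp: Sel_def \<phi>_def)
      then show ?thesis using False z unfolding sw_def by auto
    qed
    then show ?case using Suc i by (simp add: W_def CB)
  qed
  \<comment> \<open>The original path can be read off from the flipped input, as the path of
    \<open>C\<close> on it. Hence the flipped positions are known and the flip can be
    undone.\<close>
  have "inj_on \<phi> (cube ?A)"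
  proof (rule inj_onI)
    fix y y' assume y: "y \<in> cube ?A" "y' \<in> cube ?A" and eq: "\<phi> y = \<phi> y'"
    have W: "W y i = W y' i" if "i \<le> n" for i
      using walk_eq[OF y(1) that] walk_eq[OF y(2) that] eq by simp
    show "y = y'"
    proof
      fix i
      show "y i = y' i"
      proof (cases "i \<in> ?A")
        case True
        then show ?thesis using fun_cong[OF eq, of i] W[of i] by (auto simp: \<phi>_def split: if_splits)
      next
        case False
        then show ?thesis using y by (auto simp: cube_def PiE_def extensional_def)
      qed
    qed
  qed
  then have bij: "bij_betw \<phi> (cube ?A) (cube ?A)"
    using \<phi>_cube endo_inj_surj[of "cube ?A" \<phi>] by (auto simp: bij_betw_def)
  have "(\<Sum>y\<in>cube ?A. bp_eval C (Sel T x y)) = (\<Sum>y\<in>cube ?A. bp_eval C (Sel T x (\<phi> y)))"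
    using sum.reindex_bij_betw[OF bij, of "\<lambda>y. bp_eval C (Sel T x y)"] by simp
  also have "\<dots> = (\<Sum>y\<in>cube ?A. bp_eval B (Sel T x y))"
    using walk_eq[of _ n] by (intro sum.cong) (auto simp: bp_eval_def accepts_from_def CB W_def)
  finally show ?thesis
    by (simp add: Bias_def unif_def restrict_fun_def integral_pmf_of_set)
qed

subsection \<open>Cutting a restricted program at its collapsing layers\<close>

text \<open>Blocks are built from the last layer backwards, so a block grows at its front.\<close>

definition prepend :: "nat \<Rightarrow> nat \<Rightarrow> (nat \<Rightarrow> int \<Rightarrow> nat) \<Rightarrow> bp \<Rightarrow> bp" where
  "prepend i c e P =
     \<lparr> vars = i # vars P, width = case_nat c (width P), edge = case_nat e (edge P),
       accepting = accepting P \<rparr>"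

lemma prepend_simps [simp]:
  "vars (prepend i c e P) = i # vars P"
  "width (prepend i c e P) 0 = c"
  "width (prepend i c e P) (Suc j) = width P j"
  "edge (prepend i c e P) 0 = e"
  "edge (prepend i c e P) (Suc j) = edge P j"
  "accepting (prepend i c e P) = accepting P"
  by (simp_all add: prepend_def)

lemma accepts_from_prepend:
  "accepts_from (prepend i c e P) 0 v x \<longleftrightarrow> accepts_from P 0 (e v (x i)) x"
proof -
  have "walk (prepend i c e P) x (Suc 0) v k = walk P x 0 v k" for v k
    by (induction k) simp_all
  then have "walk (prepend i c e P) x 0 v (Suc k) = walk P x 0 (e v (x i)) k" for k
    by (simp only: walk_Suc_shift) simp
  then show ?thesis by (simp add: accepts_from_def del: walk.simps)
qed

lemma prepend_comp: "prepend i c e P \<circ>\<^sub>B Q = prepend i c e (P \<circ>\<^sub>B Q)"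
  by (auto simp: prepend_def bp_comp_def fun_eq_iff split: nat.splits)

lemma bp_comp_list_prepend:
  "bp_comp_list (prepend i c e P # Ps) = prepend i c e (bp_comp_list (P # Ps))"
  by (cases Ps) (simp_all add: prepend_comp)

text \<open>A program of length zero is a left unit of composition: it opens a new block with
  \<open>c\<close> start vertices without changing the computed function.\<close>

definition empty_bp :: "nat \<Rightarrow> nat set \<Rightarrow> bp" where
  "empty_bp c A = \<lparr> vars = [], width = (\<lambda>_. c), edge = (\<lambda>_ _ _. 0), accepting = A \<rparr>"

lemma empty_bp_simps [simp]:
  "vars (empty_bp c A) = []" "width (empty_bp c A) j = c" "accepting (empty_bp c A) = A"
  by (simp_all add: empty_bp_def)

lemma empty_bp_comp: "empty_bp c A \<circ>\<^sub>B P = P"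
  by (simp add: bp_comp_def)

lemma composable_Cons:
  "composable (P # Q # Ps) \<longleftrightarrow>
     width P (bp_length P) = width Q 0 \<and>
     (\<forall>R \<in> set (Q # Ps). set (vars P) \<inter> set (vars R) = {}) \<and> composable (Q # Ps)"
proof -
  have all_nat: "(\<forall>i. X i) \<longleftrightarrow> X 0 \<and> (\<forall>i. X (Suc i))" for X :: "nat \<Rightarrow> bool"
    by (metis not0_implies_Suc)
  have "(\<forall>i. Suc i < length (P # Q # Ps) \<longrightarrow>
          width ((P # Q # Ps) ! i) (bp_length ((P # Q # Ps) ! i)) = width ((P # Q # Ps) ! Suc i) 0) \<longleftrightarrow>
        width P (bp_length P) = width Q 0 \<and>
        (\<forall>i. Suc i < length (Q # Ps) \<longrightarrow>
          width ((Q # Ps) ! i) (bp_length ((Q # Ps) ! i)) = width ((Q # Ps) ! Suc i) 0)"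
    by (subst all_nat) simp
  moreover have "(\<forall>j < length (P # Q # Ps). \<forall>i < j.
          set (vars ((P # Q # Ps) ! i)) \<inter> set (vars ((P # Q # Ps) ! j)) = {}) \<longleftrightarrow>
        (\<forall>R \<in> set (Q # Ps). set (vars P) \<inter> set (vars R) = {}) \<and>
        (\<forall>j < length (Q # Ps). \<forall>i < j.
          set (vars ((Q # Ps) ! i)) \<inter> set (vars ((Q # Ps) ! j)) = {})"
    by (simp add: All_less_Suc2 all_set_conv_all_nth) blast
  ultimately show ?thesis by (simp only: composable_def) blast
qed


text \<open>The first block is still growing, hence the separate bound m on its variables and the
  start width up to w.\<close>

definition block_family ::
  "nat \<Rightarrow> real \<Rightarrow> nat set \<Rightarrow> nat \<Rightarrow> nat \<Rightarrow> nat \<Rightarrow> (nat \<Rightarrow> (nat \<Rightarrow> int) \<Rightarrow> bool) \<Rightarrow> bool" where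
  "block_family w b T j c m F \<longleftrightarrow>
     (\<exists>P Ps. composable (P # Ps) \<and>
        (\<forall>Q \<in> set (P # Ps). read_once_bp w Q \<and> set (vars Q) \<subseteq> T \<inter> {j..} \<and>
           width Q (bp_length Q) \<le> 2) \<and>
        (\<forall>Q \<in> set Ps. width Q 0 \<le> 2 \<and> real (bp_length Q) \<le> b) \<and>
        width P 0 = c \<and> bp_length P \<le> m \<and>
        (\<forall>s < c. \<forall>x \<in> cube T. F s x \<longleftrightarrow> accepts_from (bp_comp_list (P # Ps)) 0 s x))"

lemma block_family_cong:
  assumes "block_family w b T j c m F" "\<And>s x. \<lbrakk>s < c; x \<in> cube T\<rbrakk> \<Longrightarrow> F s x \<longleftrightarrow> G s x"
  shows "block_family w b T j c m G"
  using assms unfolding block_family_def by metis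

text \<open>A layer whose bit is ignored or fixed adds no edge layer to any block. The same blocks
  are merely viewed from one layer earlier.\<close>

lemma block_family_weaken:
  assumes "block_family w b T j c m F" "i \<le> j"
  shows "block_family w b T i c m F"
proof -
  from assms(1) obtain P Ps where *: "composable (P # Ps)"
    "\<forall>Q \<in> set (P # Ps). read_once_bp w Q \<and> set (vars Q) \<subseteq> T \<inter> {j..} \<and> width Q (bp_length Q) \<le> 2"
    "\<forall>Q \<in> set Ps. width Q 0 \<le> 2 \<and> real (bp_length Q) \<le> b"
    "width P 0 = c" "bp_length P \<le> m"
    "\<forall>s < c. \<forall>x \<in> cube T. F s x \<longleftrightarrow> accepts_from (bp_comp_list (P # Ps)) 0 s x"
    unfolding block_family_def by blast
  have "T \<inter> {j..} \<subseteq> T \<inter> {i..}" using assms(2) by auto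
  then have "\<forall>Q \<in> set (P # Ps). read_once_bp w Q \<and> set (vars Q) \<subseteq> T \<inter> {i..} \<and>
      width Q (bp_length Q) \<le> 2"
    using *(2) by (meson subset_trans)
  with * show ?thesis unfolding block_family_def by blast
qed

lemma block_family_const:
  assumes "c \<le> 2" "2 \<le> w"
  shows "block_family w b T j c 0 (\<lambda>s _. s \<in> A)"
  unfolding block_family_def
  by (rule exI[of _ "empty_bp c A"], rule exI[of _ "[]"])
    (use assms in \<open>auto simp: composable_def read_once_bp_def accepts_from_def\<close>)

text \<open>This is the cut: an empty program becomes the growing block, and the previous one joins
  the finished blocks. Only now must its start width be at most 2 and its size at most
  \<open>b\<close>.\<close>

lemma block_family_new_block:
  assumes "block_family w b T j c m F" "c \<le> 2" "real m \<le> b" "2 \<le> w"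
  shows "block_family w b T j c 0 F"
proof -
  from assms(1) obtain P Ps where *: "composable (P # Ps)"
    "\<forall>Q \<in> set (P # Ps). read_once_bp w Q \<and> set (vars Q) \<subseteq> T \<inter> {j..} \<and> width Q (bp_length Q) \<le> 2"
    "\<forall>Q \<in> set Ps. width Q 0 \<le> 2 \<and> real (bp_length Q) \<le> b"
    "width P 0 = c" "bp_length P \<le> m"
    "\<forall>s < c. \<forall>x \<in> cube T. F s x \<longleftrightarrow> accepts_from (bp_comp_list (P # Ps)) 0 s x"
    unfolding block_family_def by blast
  show ?thesis
    unfolding block_family_def
    by (rule exI[of _ "empty_bp c {}"], rule exI[of _ "P # Ps"])
      (use * assms(2-4) in \<open>auto simp: composable_Cons read_once_bp_def empty_bp_comp\<close>)
qed

text \<open>A growing block is bound to width 2 only at its end, so the new first layer may have any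
  width up to \<open>w\<close>. The order of reading stays increasing because all blocks so far read
  variables beyond \<open>i\<close>.\<close>

lemma block_family_layer:
  assumes F: "block_family w b T (Suc i) c m F" and "i \<in> T" "c \<le> w" "c' \<le> w"
    and e: "\<And>s a. \<lbrakk>s < c'; a \<in> {-1, 1}\<rbrakk> \<Longrightarrow> e s a < c"
  shows "block_family w b T i c' (Suc m) (\<lambda>s x. F (e s (x i)) x)"
proof -
  from F obtain P Ps where *: "composable (P # Ps)"
    "\<forall>Q \<in> set (P # Ps). read_once_bp w Q \<and> set (vars Q) \<subseteq> T \<inter> {Suc i..} \<and>
       width Q (bp_length Q) \<le> 2"
    "\<forall>Q \<in> set Ps. width Q 0 \<le> 2 \<and> real (bp_length Q) \<le> b"
    "width P 0 = c" "bp_length P \<le> m"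
    and acc: "\<forall>s < c. \<forall>x \<in> cube T. F s x \<longleftrightarrow> accepts_from (bp_comp_list (P # Ps)) 0 s x"
    unfolding block_family_def by blast
  let ?P = "prepend i c' e P"
  have later: "Suc i \<le> k" if "Q \<in> set (P # Ps)" "k \<in> set (vars Q)" for Q k
    using *(2) that by blast
  have "composable (?P # Ps)"
  proof (cases Ps)
    case Nil
    then show ?thesis by (simp add: composable_def)
  next
    case (Cons Q Qs)
    have "i \<notin> set (vars R)" if "R \<in> set Ps" for R
      using later[of R i] that by auto
    then show ?thesis using *(1) unfolding Cons composable_Cons by auto
  qed
  moreover have "read_once_bp w ?P"
    unfolding read_once_bp_def
  proof (intro conjI allI impI ballI)
    show "sorted_wrt (<) (vars ?P)"
      using *(2) later[of P] by (auto simp: read_once_bp_def Suc_le_eq)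
    show "width ?P k \<le> w" if "k \<le> bp_length ?P" for k
      using *(2) assms(4) that by (cases k) (auto simp: read_once_bp_def)
    show "edge ?P k v a < width ?P (Suc k)"
      if "k < bp_length ?P" "v < width ?P k" "a \<in> {-1, 1}" for k v a
    proof (cases k)
      case 0
      then show ?thesis using e[of v a] that *(4) by simp
    next
      case (Suc k')
      then show ?thesis using *(2) that unfolding read_once_bp_def by auto
    qed
  qed
  moreover have "accepts_from (bp_comp_list (?P # Ps)) 0 s x \<longleftrightarrow> F (e s (x i)) x"
    if "s < c'" "x \<in> cube T" for s x
    using acc e[of s "x i"] cube_apply[of x T i] that \<open>i \<in> T\<close>
    unfolding bp_comp_list_prepend accepts_from_prepend by blast
  moreover have "set (vars Q) \<subseteq> T \<inter> {i..}" if "Q \<in> set (P # Ps)" for Q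
  proof
    fix k assume "k \<in> set (vars Q)"
    then show "k \<in> T \<inter> {i..}" using *(2) that later[of Q k] by auto
  qed
  ultimately show ?thesis
    unfolding block_family_def
    by (intro exI[of _ ?P] exI[of _ Ps]) (use * \<open>i \<in> T\<close> in simp)
qed

lemma block_family_computed:
  assumes F: "block_family w b T 0 (Suc 0) m F" and m: "real m \<le> b"
    and f: "\<And>x. x \<in> cube T \<Longrightarrow> f x = (if F 0 x then -1 else 1)"
  shows "computed_by_blocks w b T f"
proof -
  from F obtain P Ps where *: "composable (P # Ps)"
    "\<forall>Q \<in> set (P # Ps). read_once_bp w Q \<and> set (vars Q) \<subseteq> T \<inter> {0..} \<and> width Q (bp_length Q) \<le> 2"
    "\<forall>Q \<in> set Ps. width Q 0 \<le> 2 \<and> real (bp_length Q) \<le> b"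
    "width P 0 = Suc 0" "bp_length P \<le> m"
    "\<forall>s < Suc 0. \<forall>x \<in> cube T. F s x \<longleftrightarrow> accepts_from (bp_comp_list (P # Ps)) 0 s x"
    unfolding block_family_def by blast
  have "real (card (set (vars Q))) \<le> b" if "Q \<in> set (P # Ps)" for Q
  proof -
    have "real (bp_length Q) \<le> b" using *(3,5) m that by auto
    then show ?thesis using card_length[of "vars Q"] by linarith
  qed
  then show ?thesis
    unfolding computed_by_blocks_def
    by (intro exI[of _ "P # Ps"]) (use * f in \<open>auto simp: bp_eval_def\<close>)
qed

text \<open>On the relevant layers from some layer on, this bounds the size of the block growing
  when the backward induction reaches that layer. A collapse resets it, since a new block is opened
  there.\<close>

primrec run_reads :: "nat set \<Rightarrow> nat set \<Rightarrow> nat list \<Rightarrow> nat" where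
  "run_reads T Z [] = 0"
| "run_reads T Z (i # is) =
     (if i \<in> T then Suc (run_reads T Z is) else if i \<in> Z then 0 else run_reads T Z is)"

lemma run_reads_le: "distinct is \<Longrightarrow> finite T \<Longrightarrow> run_reads T Z is \<le> card (set is \<inter> T)"
  by (induction "is") auto

lemma cover_by_two:
  assumes "card A \<le> 2" "A \<noteq> {}" "finite A"
  obtains p q where "p \<in> A" "q \<in> A" "A \<subseteq> {p, q}"
proof -
  have "card A = 1 \<or> card A = 2" using assms card_gt_0_iff[of A] by linarith
  then show ?thesis using that by (auto simp: card_1_singleton_iff card_2_iff)
qed

text \<open>Backward induction over the layers.  A collapsing layer ends a block: there at most
  two vertices remain, which become the start vertices of the next block.  The
  first invariant serves such a collapse; the second, which first merges vertices instead,
  ensures that the block ends with width two although the layer above it has width three.\<close>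

lemma restriction_computed_by_blocks:
  assumes C: "robp 3 n C" and T: "T \<subseteq> {..<n}" and y: "y \<in> cube ({..<n} - T)"
    and trivial: "\<And>i v. \<lbrakk>i < n; i \<notin> N; v < width C i\<rbrakk> \<Longrightarrow> edge C i v (-1) = edge C i v 1"
    and collapse: "\<And>i. \<lbrakk>i < n; i \<in> N - T; i \<in> Z\<rbrakk> \<Longrightarrow>
      card ((\<lambda>v. edge C i v (y i)) ` {..<width C i}) \<le> 2"
    and reads: "\<And>j. j \<le> n \<Longrightarrow> real (run_reads T Z (filter (\<lambda>i. i \<in> N) [j..<n])) \<le> b"
  shows "computed_by_blocks 3 b T (restrict_fun (bp_eval C) T y)"
proof -
  define m where "m j = run_reads T Z (filter (\<lambda>i. i \<in> N) [j..<n])" for j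
  define F where "F j v x = accepts_from C j v (Sel T x y)" for j v x
  have vars: "vars C = [0..<n]" using C by (simp add: robp_def)
  have W: "width C j \<le> 3" if "j \<le> n" for j
    using C that by (auto simp: robp_def read_once_bp_def)
  have E: "edge C j v a < width C (Suc j)" if "j < n" "v < width C j" "a \<in> {-1, 1}" for j v a
    using C that by (auto simp: robp_def read_once_bp_def)
  have F_step: "F j v x = F (Suc j) (edge C j v (Sel T x y j)) x" if "j < n" for j v x
    using accepts_from_step[of j C v "Sel T x y"] that by (simp add: F_def vars)
  have m_step: "m j = (if j \<in> N then if j \<in> T then Suc (m (Suc j)) else if j \<in> Z then 0
      else m (Suc j) else m (Suc j))" if "j < n" for j
    using that by (simp add: m_def upt_conv_Cons)
  have m_le: "real (m j) \<le> b" if "j \<le> n" for j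
    using reads that by (simp add: m_def)
  have main: "(\<forall>c \<phi>. c \<le> 2 \<longrightarrow> (\<forall>s < c. \<phi> s < width C j) \<longrightarrow>
          block_family 3 b T j c (m j) (\<lambda>s. F j (\<phi> s))) \<and>
        (\<exists>c \<sigma> H. c \<le> 3 \<and> (\<forall>v < width C j. \<sigma> v < c) \<and> block_family 3 b T j c (m j) H \<and>
          (\<forall>v < width C j. \<forall>x \<in> cube T. F j v x \<longleftrightarrow> H (\<sigma> v) x))"
    (is "?Q1 j \<and> ?Q2 j") if "j \<le> n" for j
    using that
  proof (induction j rule: inc_induct)
    case base
    have F: "F n v x \<longleftrightarrow> v \<in> accepting C" for v x
      by (simp add: F_def accepts_from_def vars)
    have m: "m n = 0" by (simp add: m_def)
    have "?Q1 n"
      using block_family_const[of _ 3 b T n "{s. \<phi> s \<in> accepting C}" for \<phi> :: "nat \<Rightarrow> nat"]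
      by (simp add: F m)
    moreover have "?Q2 n"
    \<comment> \<open>The vertices of the last layer are merged into a rejecting and an accepting
      one, so the last block also ends with width 2.\<close>
    proof (intro exI conjI)
      show "block_family 3 b T n 2 (m n) (\<lambda>s _. s \<in> {1})"
        unfolding m by (rule block_family_const) simp_all
      show "\<forall>v < width C n. of_bool (v \<in> accepting C) < (2 :: nat)" by simp
      show "\<forall>v < width C n. \<forall>x \<in> cube T. F n v x \<longleftrightarrow> of_bool (v \<in> accepting C) \<in> {1 :: nat}"
        by (simp add: F)
    qed simp
    ultimately show ?case by blast
  next
    case (step j)
    then have j: "j < n" by simp
    from step.IH have IH1: "block_family 3 b T (Suc j) c (m (Suc j)) (\<lambda>s. F (Suc j) (\<phi> s))"
      if "c \<le> 2" "\<forall>s < c. \<phi> s < width C (Suc j)" for c \<phi>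
      using that by blast
    from step.IH obtain c \<sigma> H where c: "c \<le> 3" and \<sigma>: "\<forall>v < width C (Suc j). \<sigma> v < c"
      and H: "block_family 3 b T (Suc j) c (m (Suc j)) H"
      and FH: "\<forall>v < width C (Suc j). \<forall>x \<in> cube T. F (Suc j) v x \<longleftrightarrow> H (\<sigma> v) x"
      by blast
    consider (read) "j \<in> N \<inter> T" | (fixed) "j \<notin> N \<inter> T" "j \<notin> N - T \<or> j \<notin> Z"
      | (collapse) "j \<in> N - T" "j \<in> Z"
      by blast
    then show ?case
    proof cases
      case read
      then have m: "m j = Suc (m (Suc j))" using m_step[OF j] by simp
      have F: "F j v x \<longleftrightarrow> H (\<sigma> (edge C j v (x j))) x" if "v < width C j" "x \<in> cube T" for v x
        using FH E[OF j that(1) cube_apply[OF that(2)]] F_step[OF j] read that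
        by (simp add: Sel_def)
      \<comment> \<open>Both invariants are derived from the merged family \<open>H\<close> of the
        next layer. The first invariant there admits only two start vertices, whereas a read layer
        may reach three.\<close>
      have layer: "block_family 3 b T j c' (m j) (\<lambda>s. F j (\<phi> s))"
        if "c' \<le> 3" "\<forall>s < c'. \<phi> s < width C j" for c' \<phi>
      proof -
        have "block_family 3 b T j c' (Suc (m (Suc j))) (\<lambda>s x. H (\<sigma> (edge C j (\<phi> s) (x j))) x)"
          by (rule block_family_layer[OF H, where e = "\<lambda>s a. \<sigma> (edge C j (\<phi> s) a)"])
            (use read c that \<sigma> E[OF j] in auto)
        then show ?thesis unfolding m by (rule block_family_cong) (use F that in auto)
      qed
      have "?Q2 j"
        by (rule exI[of _ "width C j"], rule exI[of _ id], rule exI[of _ "F j"])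
          (use W[of j] j layer[of "width C j" id] in simp)
      then show ?thesis using layer by auto
    next
      case fixed
      \<comment> \<open>If \<open>j\<close> lies in \<open>T\<close>, this case forces it outside
        \<open>N\<close>; the layer then ignores its bit and the label 1 is as good as any.\<close>
      define a where "a = (if j \<in> T then 1 else y j)"
      have a: "a \<in> {-1, 1}" using cube_apply[OF y, of j] j by (auto simp: a_def)
      have m: "m j = m (Suc j)" using m_step[OF j] fixed by auto
      have F: "F j v x = F (Suc j) (edge C j v a) x" if "v < width C j" "x \<in> cube T" for v x
        using F_step[OF j, of v x] trivial[OF j _ that(1)] fixed(1) cube_apply[OF that(2), of j]
        by (auto simp: Sel_def a_def)
      have "?Q1 j"
      proof (intro allI impI)
        fix c' :: nat and \<phi> :: "nat \<Rightarrow> nat" assume *: "c' \<le> 2" "\<forall>s < c'. \<phi> s < width C j"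
        have "block_family 3 b T (Suc j) c' (m j) (\<lambda>s. F (Suc j) (edge C j (\<phi> s) a))"
          unfolding m by (rule IH1) (use * E[OF j _ a] in auto)
        then have "block_family 3 b T j c' (m j) (\<lambda>s. F (Suc j) (edge C j (\<phi> s) a))"
          by (rule block_family_weaken) simp
        then show "block_family 3 b T j c' (m j) (\<lambda>s. F j (\<phi> s))"
          by (rule block_family_cong) (use * F in auto)
      qed
      moreover have "?Q2 j"
        by (rule exI[of _ c], rule exI[of _ "\<lambda>v. \<sigma> (edge C j v a)"], rule exI[of _ H])
          (use c \<sigma> FH F E[OF j _ a] block_family_weaken[OF H, of j] m in auto)
      ultimately show ?thesis by blast
    next
      case collapse
      have y_j: "y j \<in> {-1, 1}" using cube_apply[OF y, of j] j collapse by auto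
      have m: "m j = 0" using m_step[OF j] collapse by auto
      have F: "F j v x = F (Suc j) (edge C j v (y j)) x" for v x
        using F_step[OF j, of v x] collapse by (simp add: Sel_def)
      \<comment> \<open>The block being closed has at most \<open>b\<close> layers because the runs
        from every layer, not only from the first, are assumed short.\<close>
      have new: "block_family 3 b T j c' (m j) (\<lambda>s. F (Suc j) (\<psi> s))"
        if "c' \<le> 2" "\<forall>s < c'. \<psi> s < width C (Suc j)" for c' \<psi>
      proof -
        have "block_family 3 b T (Suc j) c' 0 (\<lambda>s. F (Suc j) (\<psi> s))"
          using that IH1 m_le[of "Suc j"] j by (intro block_family_new_block[OF IH1]) auto
        then show ?thesis unfolding m by (rule block_family_weaken) simp
      qed
      have "?Q1 j" using new E[OF j _ y_j] by (simp add: F)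
      moreover have "?Q2 j"
      proof (cases "width C j = 0")
        case True
        then show ?thesis using new[of 0 id] by (intro exI[of _ 0]) auto
      next
        case False
        let ?A = "(\<lambda>v. edge C j v (y j)) ` {..<width C j}"
        obtain p q where pq: "p \<in> ?A" "q \<in> ?A" "?A \<subseteq> {p, q}"
          using cover_by_two[of ?A] collapse False j \<open>\<And>i. \<lbrakk>i < n; i \<in> N - T; i \<in> Z\<rbrakk> \<Longrightarrow>
            card ((\<lambda>v. edge C i v (y i)) ` {..<width C i}) \<le> 2\<close> by auto
        have less: "p < width C (Suc j)" "q < width C (Suc j)"
          using pq(1,2) E[OF j _ y_j] by auto
        \<comment> \<open>Start vertices 0 and 1 of the new block stand for \<open>p\<close> and
          \<open>q\<close>, which may coincide. The collapsed layer itself is absorbed into the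
          merging map, so it costs no edge layer.\<close>
        let ?\<psi> = "\<lambda>s :: nat. if s = 0 then p else q"
        let ?\<sigma> = "\<lambda>v. of_bool (edge C j v (y j) \<noteq> p) :: nat"
        have "F j v x = F (Suc j) (?\<psi> (?\<sigma> v)) x" if "v < width C j" for v x
          using pq(3) that by (auto simp: F)
        moreover have "block_family 3 b T j 2 (m j) (\<lambda>s. F (Suc j) (?\<psi> s))"
          by (rule new) (use less in auto)
        ultimately show ?thesis
          by (intro exI[of _ 2] exI[of _ ?\<sigma>] exI[of _ "\<lambda>s. F (Suc j) (?\<psi> s)"]) auto
      qed
      ultimately show ?thesis by blast
    qed
  qed
  have "block_family 3 b T 0 (Suc 0) (m 0) (\<lambda>s. F 0 0)"
    using main[of 0] C by (auto simp: robp_def)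
  then show ?thesis
    by (rule block_family_computed)
      (use m_le in \<open>auto simp: restrict_fun_def bp_eval_def F_def\<close>)
qed

text \<open>For two permutations the ranks of the successors have equal sums, so the
  monotone inequality between them is an equality everywhere and the layer ignores its bit.\<close>

lemma monotone_layer_collapse:
  assumes C: "robp 3 n C" and i: "i < n"
    and rk: "bij_betw (rk (Suc i)) {..<width C (Suc i)} {..<width C (Suc i)}"
    and mono: "locally_monotone rk C i"
    and nontrivial: "v < width C i" "edge C i v (-1) \<noteq> edge C i v 1"
  obtains a where "a \<in> {-1, 1}" "card ((\<lambda>v. edge C i v a) ` {..<width C i}) \<le> 2"
proof (rule ccontr)
  assume neg: "\<not> thesis"
  let ?V = "{..<width C i}" and ?V' = "{..<width C (Suc i)}"
  have w: "width C i \<le> 3" "width C (Suc i) \<le> 3"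
    using C i by (auto simp: robp_def read_once_bp_def)
  have sum: "(\<Sum>v\<in>?V. rk (Suc i) (edge C i v a)) = (\<Sum>{..<width C (Suc i)})" if "a \<in> {-1, 1}" for a
  proof -
    let ?f = "\<lambda>v. edge C i v a"
    have "card (?f ` ?V) > 2" using neg that \<open>\<And>a. \<lbrakk>a \<in> {-1, 1}; _\<rbrakk> \<Longrightarrow> thesis\<close> not_le by blast
    moreover have sub: "?f ` ?V \<subseteq> ?V'"
      using C i that by (auto simp: robp_def read_once_bp_def)
    moreover have "card (?f ` ?V) \<le> card ?V'" using sub by (intro card_mono) auto
    moreover have "card (?f ` ?V) \<le> width C i" using card_image_le[of ?V ?f] by simp
    \<comment> \<open>An image with more than two elements, between layers of width at most 3,
      forces both widths to be exactly 3.\<close>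
    ultimately have "card (?f ` ?V) = card ?V" "card (?f ` ?V) = card ?V'" using w by auto
    then have "bij_betw ?f ?V ?V'"
      using sub by (simp add: bij_betw_def eq_card_imp_inj_on card_subset_eq)
    then have "bij_betw (rk (Suc i) \<circ> ?f) ?V ?V'" using rk bij_betw_trans by blast
    from sum.reindex_bij_betw[OF this, of id] show ?thesis by simp
  qed
  have "rk (Suc i) (edge C i v (-1)) = rk (Suc i) (edge C i v 1)"
  proof (rule ccontr)
    assume "rk (Suc i) (edge C i v (-1)) \<noteq> rk (Suc i) (edge C i v 1)"
    then have "(\<Sum>v\<in>?V. rk (Suc i) (edge C i v (-1))) < (\<Sum>v\<in>?V. rk (Suc i) (edge C i v 1))"
      using mono nontrivial(1) unfolding locally_monotone_def
      by (intro sum_strict_mono_strong[of _ v]) (auto simp: order.strict_iff_order)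
    then show False using sum[of 1] sum[of "-1"] by simp
  qed
  moreover have "edge C i v a < width C (Suc i)" if "a \<in> {-1, 1}" for a
    using C i nontrivial(1) that by (auto simp: robp_def read_once_bp_def)
  ultimately show False
    using rk nontrivial(2) unfolding bij_betw_def inj_on_def by auto
qed


subsection \<open>Long runs without a collapse\<close>

text \<open>A run along the listed layers is long if it contains k layers of T before it meets a
  collapsing one; e decides the case of a list that ends before either happens.\<close>

fun long_run :: "nat set \<Rightarrow> nat set \<Rightarrow> bool \<Rightarrow> nat \<Rightarrow> nat list \<Rightarrow> bool" where
  "long_run T Z e 0 is = True"
| "long_run T Z e (Suc k) [] = e"
| "long_run T Z e (Suc k) (i # is) =
     (if i \<in> T then long_run T Z e k is else i \<notin> Z \<and> long_run T Z e (Suc k) is)"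

text \<open>Many reads show up as a long run even in a window of bounded length. If the window cuts
  the list short, the run may be undecided at its end and must count as long; a window containing
  the whole list needs no such allowance.\<close>

lemma run_reads_long_run:
  assumes "k \<le> run_reads T Z is" "l < length is \<Longrightarrow> e"
  shows "long_run T Z e k (take l is)"
  using assms
proof (induction "is" arbitrary: k l)
  case Nil
  then show ?case by simp
next
  case (Cons i "is")
  show ?case
  proof (cases k)
    case (Suc k')
    with Cons show ?thesis by (cases l) (auto split: if_splits)
  qed simp
qed

lemma long_run_cong:
  "(\<And>i. i \<in> set is \<Longrightarrow> i \<in> Z \<longleftrightarrow> i \<in> Z') \<Longrightarrow> long_run T Z e k is \<longleftrightarrow> long_run T Z' e k is"
  by (induction T Z e k "is" rule: long_run.induct) auto

text \<open>This is the conditional probability of a long run given \<open>T\<close>: each listed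
  layer outside \<open>T\<close> receives its collapsing label with probability 1/2, independently
  of the others.\<close>

fun run_prob :: "nat set \<Rightarrow> bool \<Rightarrow> nat \<Rightarrow> nat list \<Rightarrow> real" where
  "run_prob T e 0 is = 1"
| "run_prob T e (Suc k) [] = of_bool e"
| "run_prob T e (Suc k) (i # is) =
     (if i \<in> T then run_prob T e k is else run_prob T e (Suc k) is / 2)"

text \<open>Flipping coordinate \<open>i\<close> pairs the inputs that miss the label
  \<open>a\<close> with those that hit it, and preserves \<open>P\<close>.\<close>

lemma unif_half:
  assumes "finite A" "i \<in> A" "a \<in> {-1, 1}"
    and inv: "\<And>y b. P (y(i := b)) = P y"
  shows "measure_pmf.prob (unif A) {y. y i \<noteq> a \<and> P y} = measure_pmf.prob (unif A) {y. P y} / 2"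
proof -
  let ?flip = "\<lambda>y. y(i := - y i)"
  let ?E = "{y \<in> cube A. P y}"
  let ?E1 = "{y \<in> cube A. y i \<noteq> a \<and> P y}" and ?E2 = "{y \<in> cube A. y i = a \<and> P y}"
  have flip: "?flip y \<in> cube A" if "y \<in> cube A" for y
    using that assms(2) cube_apply[OF that assms(2)]
    unfolding cube_def by (auto simp: PiE_iff extensional_def)
  have opposite: "- y i = a \<longleftrightarrow> y i \<noteq> a" if "y \<in> cube A" for y
    using cube_apply[OF that assms(2)] assms(3) by auto
  have "bij_betw ?flip ?E1 ?E2"
  proof (rule bij_betw_byWitness[where f' = ?flip])
    show "?flip ` ?E1 \<subseteq> ?E2"
    proof safe
      fix y assume "y \<in> cube A" "y i \<noteq> a" "P y"
      then show "?flip y \<in> cube A" "(?flip y) i = a" "P (?flip y)"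
        using flip[of y] opposite[of y] inv[of y] by simp_all
    qed
    show "?flip ` ?E2 \<subseteq> ?E1"
    proof safe
      fix y assume y: "y \<in> cube A" "P y" "a = y i"
      then show "?flip y \<in> cube A" "P (?flip y)"
        using flip[of y] inv[of y] by simp_all
      assume "(?flip y) i = y i"
      then show False using opposite[of y] y by simp
    qed
  qed auto
  then have "card ?E1 = card ?E2" by (rule bij_betw_same_card)
  moreover have "card ?E = card ?E1 + card ?E2"
    by (subst card_Un_disjoint[symmetric])
      (use assms(1) in \<open>auto intro!: arg_cong[where f = card]\<close>)
  ultimately have "card ?E = 2 * card ?E1" by simp
  then show ?thesis
    using assms(1) by (simp add: unif_def measure_pmf_of_set Int_def)
qed

lemma prob_long_run:
  assumes "finite A" "distinct is" "set is \<subseteq> T \<union> A" "A \<inter> T = {}" "\<And>i. c i \<in> {-1, 1}"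
  shows "measure_pmf.prob (unif A) {y. long_run T {i. y i = c i} e k is} = run_prob T e k is"
  using assms(2,3)
proof (induction T e k "is" rule: run_prob.induct)
  case (3 T e k i "is")
  show ?case
  proof (cases "i \<in> T")
    case True
    with 3 show ?thesis by simp
  next
    case False
    then have "i \<in> A" using 3 by auto
    \<comment> \<open>Distinctness keeps \<open>i\<close> out of the rest of the list, so the
      remaining event does not depend on \<open>y i\<close>.\<close>
    have "long_run T {j. (y(i := b)) j = c j} e (Suc k) is =
        long_run T {j. y j = c j} e (Suc k) is" for y b
      using 3 by (intro long_run_cong) auto
    from unif_half[OF assms(1) \<open>i \<in> A\<close> assms(5)[of i], OF this]
    show ?thesis using 3 False by simp
  qed
qed auto

section \<open>Comparison of a small-bias set with independent layers\<close>

fun ideal_prob :: "bool \<Rightarrow> nat \<Rightarrow> nat \<Rightarrow> real" where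
  "ideal_prob e 0 l = 1"
| "ideal_prob e (Suc k) 0 = of_bool e"
| "ideal_prob e (Suc k) (Suc l) = ideal_prob e k l / 2 + ideal_prob e (Suc k) l / 4"

text \<open>Along independent layers, the number of layers of T seen before the first
  collapse is geometric with ratio (1/2) / (1/2 + 1/4).\<close>

lemma ideal_prob_le: "ideal_prob e k l \<le> (2/3) ^ k + of_bool e * (3/4) ^ l"
proof (induction e k l rule: ideal_prob.induct)
  case (3 e k l)
  then show ?case by (simp add: field_simps)
qed auto

text \<open>Small bias controls only the events that a set is contained in \<open>T\<close>, so the
  layers already required to lie in \<open>T\<close> are carried along as \<open>R\<close>. The
  event that \<open>i\<close> is absent is removed by inclusion-exclusion. The three resulting
  expectations have weights 1, 1/2 and 1/2, so the error doubles with each layer.\<close>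

lemma biased_run_prob:
  assumes D: "biased_subset_distr n \<delta> (1/2) D" and "\<delta> \<ge> 0"
    and "distinct is" "set is \<subseteq> {..<n}" "R \<subseteq> {..<n}" "R \<inter> set is = {}"
  shows "\<bar>measure_pmf.expectation D (\<lambda>T. of_bool (R \<subseteq> T) * run_prob T e k is)
           - (1/2) ^ card R * ideal_prob e k (length is)\<bar> \<le> 2 ^ length is * \<delta>"
proof -
  have fin: "finite (set_pmf D)"
    using D finite_subset[of "set_pmf D" "Pow {..<n}"] by (simp add: biased_subset_distr_def)
  have marginal: "\<bar>measure_pmf.expectation D (\<lambda>T. of_bool (R \<subseteq> T)) - (1/2) ^ card R\<bar> \<le> \<delta>"
    if "R \<subseteq> {..<n}" for R
  proof -
    have "measure_pmf.expectation D (\<lambda>T. of_bool (R \<subseteq> T)) = measure_pmf.prob D {T. R \<subseteq> T}"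
    proof -
      have "(\<lambda>T. of_bool (R \<subseteq> T)) = (indicator {T. R \<subseteq> T} :: _ \<Rightarrow> real)"
        by (simp add: fun_eq_iff indicator_def)
      then show ?thesis by simp
    qed
    then show ?thesis using D that \<open>\<delta> \<ge> 0\<close> by (cases "R = {}") (auto simp: biased_subset_distr_def)
  qed
  show ?thesis
    using assms(3-6)
  proof (induction e k "length is" arbitrary: "is" R rule: ideal_prob.induct)
    case (1 e "is")
    have "\<delta> \<le> 2 ^ length is * \<delta>" using \<open>\<delta> \<ge> 0\<close> by (simp add: mult_le_cancel_right1)
    then show ?case using marginal[OF 1(3)] by simp
  next
    case (2 e k)
    then show ?case using marginal[of R] \<open>\<delta> \<ge> 0\<close> by (cases e) auto
  next
    case (3 e k l)
    then obtain i js where is_eq: "is = i # js" and l: "l = length js"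
      by (cases "is") auto
    let ?E = "\<lambda>R k. measure_pmf.expectation D (\<lambda>T. of_bool (R \<subseteq> T) * run_prob T e k js)"
    have "i \<notin> R" "finite R" using 3(6,7) finite_subset[of R "{..<n}"] is_eq by auto
    have IH1: "\<bar>?E (insert i R) k - (1/2) ^ card (insert i R) * ideal_prob e k l\<bar> \<le> 2 ^ l * \<delta>"
      using 3(1)[OF l, of "insert i R"] 3(4-) \<open>i \<notin> R\<close> is_eq l by auto
    have IH2: "\<bar>?E R (Suc k) - (1/2) ^ card R * ideal_prob e (Suc k) l\<bar> \<le> 2 ^ l * \<delta>"
      using 3(2)[OF l, of R] 3(4-) \<open>i \<notin> R\<close> is_eq l by auto
    have IH3: "\<bar>?E (insert i R) (Suc k) - (1/2) ^ card (insert i R) * ideal_prob e (Suc k) l\<bar>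
        \<le> 2 ^ l * \<delta>"
      using 3(2)[OF l, of "insert i R"] 3(4-) \<open>i \<notin> R\<close> is_eq l by auto
    \<comment> \<open>If \<open>i\<close> is in \<open>T\<close>, the difference in the second
      summand vanishes; otherwise both terms with \<open>insert i R\<close> vanish.\<close>
    have "measure_pmf.expectation D (\<lambda>T. of_bool (R \<subseteq> T) * run_prob T e (Suc k) is) =
       measure_pmf.expectation D (\<lambda>T. of_bool (insert i R \<subseteq> T) * run_prob T e k js
         + (of_bool (R \<subseteq> T) * run_prob T e (Suc k) js
            - of_bool (insert i R \<subseteq> T) * run_prob T e (Suc k) js) / 2)"
      by (intro arg_cong[where f = "measure_pmf.expectation D"]) (auto simp: is_eq fun_eq_iff)
    also have "\<dots> = ?E (insert i R) k + (?E R (Suc k) - ?E (insert i R) (Suc k)) / 2"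
      using fin by (simp add: integrable_measure_pmf_finite)
    finally have exact: "measure_pmf.expectation D (\<lambda>T. of_bool (R \<subseteq> T) * run_prob T e (Suc k) is) =
      ?E (insert i R) k + (?E R (Suc k) - ?E (insert i R) (Suc k)) / 2" .
    define u v where "u = (1/2) ^ card R * ideal_prob e k l"
      and "v = (1/2) ^ card R * ideal_prob e (Suc k) l"
    have "\<bar>?E (insert i R) k - u / 2\<bar> \<le> 2 ^ l * \<delta>" "\<bar>?E R (Suc k) - v\<bar> \<le> 2 ^ l * \<delta>"
      "\<bar>?E (insert i R) (Suc k) - v / 2\<bar> \<le> 2 ^ l * \<delta>"
      using IH1 IH2 IH3 \<open>i \<notin> R\<close> \<open>finite R\<close> by (simp_all add: u_def v_def)
    then have "\<bar>?E (insert i R) k + (?E R (Suc k) - ?E (insert i R) (Suc k)) / 2 - (u / 2 + v / 4)\<bar>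
        \<le> 2 * (2 ^ l * \<delta>)"
      unfolding abs_le_iff by argo
    then show ?case
      unfolding exact by (simp add: is_eq l[symmetric] u_def v_def distrib_left)
  qed
qed

lemma prob_restriction_distr:
  assumes "finite (set_pmf D)"
  shows "measure_pmf.prob (restriction_distr n D) E =
    measure_pmf.expectation D (\<lambda>T. measure_pmf.prob (unif ({..<n} - T)) {y. (T, y) \<in> E})"
proof -
  have "emeasure (measure_pmf (restriction_distr n D)) E =
      (\<integral>\<^sup>+T. emeasure (measure_pmf (unif ({..<n} - T))) {y. (T, y) \<in> E} \<partial>measure_pmf D)"
    unfolding restriction_distr_def
    by (auto simp: map_pmf_def[symmetric] vimage_def intro!: nn_integral_cong)
  also have "\<dots> = (\<integral>\<^sup>+T. ennreal (measure_pmf.prob (unif ({..<n} - T)) {y. (T, y) \<in> E}) \<partial>measure_pmf D)"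
    by (simp add: measure_pmf.emeasure_eq_measure)
  also have "\<dots> = ennreal (measure_pmf.expectation D
      (\<lambda>T. measure_pmf.prob (unif ({..<n} - T)) {y. (T, y) \<in> E}))"
    using assms by (intro nn_integral_eq_integral integrable_measure_pmf_finite) auto
  finally show ?thesis
    by (simp add: measure_pmf.emeasure_eq_measure integral_nonneg_AE)
qed

text \<open>The collapsing labels may depend on \<open>T\<close> because \<open>y\<close> is drawn
  after it: the conditional probability given \<open>T\<close> is the same for every choice of
  labels.\<close>

lemma prob_long_run_biased:
  assumes D: "biased_subset_distr n \<delta> (1/2) D" and "\<delta> \<ge> 0"
    and "distinct is" "set is \<subseteq> {..<n}" "\<And>T i. c T i \<in> {-1, 1}"
  shows "measure_pmf.prob (restriction_distr n D) {(T, y). long_run T {i. y i = c T i} e k is}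
    \<le> (2/3) ^ k + of_bool e * (3/4) ^ length is + 2 ^ length is * \<delta>"
proof -
  have fin: "finite (set_pmf D)"
    using D finite_subset[of "set_pmf D" "Pow {..<n}"] by (simp add: biased_subset_distr_def)
  have "measure_pmf.prob (restriction_distr n D) {(T, y). long_run T {i. y i = c T i} e k is} =
      measure_pmf.expectation D (\<lambda>T. run_prob T e k is)"
    using assms(3-5) by (subst prob_restriction_distr[OF fin])
      (auto intro!: arg_cong[where f = "measure_pmf.expectation D"] prob_long_run)
  also have "\<dots> \<le> ideal_prob e k (length is) + 2 ^ length is * \<delta>"
    using biased_run_prob[OF D assms(2-4), of "{}" e k] by simp
  also have "\<dots> \<le> (2/3) ^ k + of_bool e * (3/4) ^ length is + 2 ^ length is * \<delta>"
    using ideal_prob_le[of e k "length is"] by simp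
  finally show ?thesis .
qed

text \<open>With \<open>N\<close> equal to n/\<epsilon>, this bounds the failure probability at one
  starting layer by \<epsilon>/n, ready for a union bound over n layers.\<close>

lemma numeric_bound:
  fixes N :: real
  assumes N: "N \<ge> 8" and k: "3 * log 2 N \<le> real k"
    and L: "6 * log 2 N \<le> real L" "real L \<le> 6 * log 2 N + 1"
  shows "(2/3) ^ k + (3/4) ^ L + 2 ^ L / N ^ 10 \<le> 1 / N"
proof -
  define l where "l = log 2 N"
  have l: "l \<ge> 3" using N by (simp add: l_def le_log_iff)
  have N_eq: "N = 2 powr l" using N by (simp add: l_def)
  have half: "(1/2) powr l = 1 / N"
    by (simp add: N_eq powr_divide)
  \<comment> \<open>The factor 1/2 in \<open>r / 2\<close> turns into 1/N after raising to the power
    \<open>l\<close>; the remaining \<open>r\<close> supplies the constant, since \<open>l\<close>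
    is at least 3.\<close>
  have small: "q ^ j \<le> r ^ 3 / N"
    if "0 < q" "q \<le> 1" "m * l \<le> real j" "q powr m \<le> r / 2" "r \<le> 1" "0 < r" for q r m :: real and j
  proof -
    have "q ^ j = q powr real j" using that by (simp add: powr_realpow)
    also have "\<dots> \<le> q powr (m * l)" using that powr_mono' by simp
    also have "\<dots> = (q powr m) powr l" by (simp add: powr_powr)
    also have "\<dots> \<le> (r / 2) powr l" using that l by (intro powr_mono2) auto
    also have "\<dots> = r powr l / N"
      using half that powr_mult[of r "1/2" l] by simp
    also have "\<dots> \<le> r powr 3 / N"
      using that l N powr_mono'[of 3 l r] by (intro divide_right_mono) auto
    also have "\<dots> = r ^ 3 / N" using that by (simp add: powr_numeral)
    finally show ?thesis .
  qed
  \<comment> \<open>The multipliers 3 and 6 of the logarithm are enough because (2/3)^3 < (2/3)/2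
    and (3/4)^6 < (1/2)/2.\<close>
  have "(2/3) ^ k \<le> (2/3) ^ 3 / N"
    by (rule small[where m = 3]) (use k in \<open>auto simp: l_def power3_eq_cube\<close>)
  moreover have "(3/4) ^ L \<le> (1/2) ^ 3 / N"
    by (rule small[where m = 6]) (use L in \<open>auto simp: l_def power_numeral_reduce\<close>)
  moreover have "2 ^ L / N ^ 10 \<le> (1/4) / N"
  proof -
    have "(2::real) ^ L = 2 powr real L" by (simp add: powr_realpow)
    also have "\<dots> \<le> 2 powr (6 * l + 1)" using L by (simp add: l_def)
    also have "\<dots> = 2 * N ^ 6" 
      using powr_powr[of 2 l 6] powr_numeral[of N] N by (simp add: N_eq powr_add mult.commute)
    finally have "2 ^ L / N ^ 10 \<le> 2 * N ^ 6 / N ^ 10" using N by (simp add: divide_right_mono)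
    also have "\<dots> = 2 / N ^ 3 / N" using N by (simp add: field_simps power_numeral_reduce)
    also have "\<dots> \<le> (1/4) / N"
      using N power_mono[of 8 N 3] by (intro divide_right_mono) (auto simp: field_simps)
    finally show ?thesis .
  qed
  moreover have "((2/3) ^ 3 + (1/2) ^ 3 + 1/4) / N \<le> 1 / N"
    using N by (intro divide_right_mono) (auto simp: power3_eq_cube)
  ultimately show ?thesis by (simp add: add_divide_distrib)
qed


section \<open>Bounding the failure probability: small cases and the union bound\<close>

theorem theorem4p1:
  fixes n :: nat and \<epsilon> :: real and B :: bp and BT :: "nat set \<Rightarrow> bp"
    and rk :: "nat \<Rightarrow> nat \<Rightarrow> nat" and D :: "nat set pmf"
  assumes n_pos: "n \<ge> 1"
    and eps_pos: "\<epsilon> > 0"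
    and B: "robp 3 n B"
    and rk: "vertex_order B rk"
    and D: "biased_subset_distr n ((\<epsilon> / real n) ^ 10) (1/2) D"
    and BT: "\<And>T. T \<in> set_pmf D \<Longrightarrow> monotone_relabeling rk n T B (BT T)"
  shows "(\<forall>T \<in> set_pmf D. \<forall>x \<in> cube T.
            Bias n T (bp_eval B) x = Bias n T (bp_eval (BT T)) x \<and>
            Bias n T (bp_eval (BT T)) x =
              measure_pmf.expectation (unif ({..<n} - T))
                (\<lambda>y. restrict_fun (bp_eval (BT T)) T y x)) \<and>
         ((n = 1 \<longrightarrow> \<epsilon> \<notin> {9/10<..<1}) \<longrightarrow>
          measure_pmf.prob (restriction_distr n D)
            {(T, y). computed_by_blocks 3 (3 * log 2 (real n / \<epsilon>)) T
                       (restrict_fun (bp_eval (BT T)) T y)} \<ge> 1 - \<epsilon>)"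
proof (intro conjI ballI impI)
  fix T x assume T: "T \<in> set_pmf D" and x: "x \<in> cube T"
  show "Bias n T (bp_eval B) x = Bias n T (bp_eval (BT T)) x"
    using BT[OF T] by (intro Bias_relabeling[OF B _ x]) (simp add: monotone_relabeling_def)
  show "Bias n T (bp_eval (BT T)) x =
      measure_pmf.expectation (unif ({..<n} - T)) (\<lambda>y. restrict_fun (bp_eval (BT T)) T y x)"
    by (simp add: Bias_def)
next
  assume n_1: "n = 1 \<longrightarrow> \<epsilon> \<notin> {9/10<..<1}"
  let ?M = "restriction_distr n D"
  define b where "b = 3 * log 2 (real n / \<epsilon>)"
  define G where "G = {(T, y). computed_by_blocks 3 b T (restrict_fun (bp_eval (BT T)) T y)}"
  \<comment> \<open>Swapping labels does not affect whether a layer ignores its bit, so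
    \<open>N\<close> is the same for all relabelings. The windows are thus fixed before
    \<open>T\<close> is drawn, as the small-bias estimate requires.\<close>
  define N where "N = {i. i < n \<and> (\<exists>v < width B i. edge B i v (-1) \<noteq> edge B i v 1)}"
  define layers where "layers j = filter (\<lambda>i. i \<in> N) [j..<n]" for j
  have vars: "vars B = [0..<n]" using B by (simp add: robp_def)
  have supp: "T \<subseteq> {..<n}" "finite T" if "T \<in> set_pmf D" for T
    using D that finite_subset[of T "{..<n}"] by (auto simp: biased_subset_distr_def)
  have fin: "finite (set_pmf D)"
    using supp(1) finite_subset[of "set_pmf D" "Pow {..<n}"] by auto
  have edge_BT: "(edge (BT T) i v (-1) = edge B i v (-1) \<and> edge (BT T) i v 1 = edge B i v 1) \<or>
      (edge (BT T) i v (-1) = edge B i v 1 \<and> edge (BT T) i v 1 = edge B i v (-1))"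
    if "T \<in> set_pmf D" "i < n" "v < width B i" for T i v
    using BT[OF that(1)] that(2,3) vars by (auto simp: monotone_relabeling_def relabeling_def)
  have robp_BT: "robp 3 n (BT T)" and width_BT: "width (BT T) = width B" if "T \<in> set_pmf D" for T
  proof -
    have relab: "relabeling ({..<n} - T) B (BT T)"
      using BT[OF that] by (simp add: monotone_relabeling_def)
    show "robp 3 n (BT T)" by (rule relabeling_robp[OF relab B])
    show "width (BT T) = width B" using relab by (simp add: relabeling_def)
  qed
  \<comment> \<open>The collapsing label is chosen from \<open>T\<close> alone and not from
    \<open>y\<close>. Where no collapse is required, any valid label serves as the default.\<close>
  have "\<exists>a \<in> {-1, 1}. T \<in> set_pmf D \<and> i \<in> N - T \<longrightarrow>
      card ((\<lambda>v. edge (BT T) i v a) ` {..<width (BT T) i}) \<le> 2" for T i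
  proof (cases "T \<in> set_pmf D \<and> i \<in> N - T")
    case True
    then have T: "T \<in> set_pmf D" and i: "i < n" "i \<notin> T" by (auto simp: N_def)
    obtain v where v: "v < width B i" "edge B i v (-1) \<noteq> edge B i v 1"
      using True by (auto simp: N_def)
    obtain a where "a \<in> {-1, 1}" "card ((\<lambda>v. edge (BT T) i v a) ` {..<width (BT T) i}) \<le> 2"
    proof (rule monotone_layer_collapse[OF robp_BT[OF T] i(1)])
      show "bij_betw (rk (Suc i)) {..<width (BT T) (Suc i)} {..<width (BT T) (Suc i)}"
        using rk i vars by (simp add: vertex_order_def width_BT[OF T])
      show "locally_monotone rk (BT T) i"
        using BT[OF T] i by (simp add: monotone_relabeling_def)
      show "v < width (BT T) i" using v by (simp add: width_BT[OF T])
      show "edge (BT T) i v (-1) \<noteq> edge (BT T) i v 1"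
        using edge_BT[OF T i(1) v(1)] v(2) by auto
    qed
    then show ?thesis by blast
  qed auto
  then obtain c :: "nat set \<Rightarrow> nat \<Rightarrow> int" where c: "\<And>T i. c T i \<in> {-1, 1}"
    and c_collapse: "\<And>T i. \<lbrakk>T \<in> set_pmf D; i \<in> N - T\<rbrakk> \<Longrightarrow>
      card ((\<lambda>v. edge (BT T) i v (c T i)) ` {..<width (BT T) i}) \<le> 2"
    by metis
  have set_M: "T \<in> set_pmf D" "y \<in> cube ({..<n} - T)" if "(T, y) \<in> set_pmf ?M" for T y
    using that by (auto simp: restriction_distr_def unif_def)
  have good: "(T, y) \<in> G" if "(T, y) \<in> set_pmf ?M"
    "\<And>j. j \<le> n \<Longrightarrow> real (run_reads T {i. y i = c T i} (layers j)) \<le> b" for T y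
  proof -
    note T = set_M(1)[OF that(1)]
    have "computed_by_blocks 3 b T (restrict_fun (bp_eval (BT T)) T y)"
    proof (rule restriction_computed_by_blocks
        [OF robp_BT[OF T] supp(1)[OF T] set_M(2)[OF that(1)],
         where N = N and Z = "{i. y i = c T i}"])
      show "edge (BT T) i v (-1) = edge (BT T) i v 1"
        if "i < n" "i \<notin> N" "v < width (BT T) i" for i v
        using edge_BT[OF T that(1), of v] that width_BT[OF T] by (auto simp: N_def)
      show "card ((\<lambda>v. edge (BT T) i v (y i)) ` {..<width (BT T) i}) \<le> 2"
        if "i \<in> N - T" "i \<in> {i. y i = c T i}" for i
        using c_collapse[OF T that(1)] that(2) by simp
    qed (use that(2) in \<open>simp add: layers_def\<close>)
    then show ?thesis by (simp add: G_def)
  qed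
  have reads_le: "run_reads T Z (layers j) \<le> card T" if "T \<in> set_pmf D" for T Z j
  proof -
    have "run_reads T Z (layers j) \<le> card (set (layers j) \<inter> T)"
      using supp(2)[OF that] by (intro run_reads_le) (auto simp: layers_def)
    also have "\<dots> \<le> card T" using supp(2)[OF that] by (intro card_mono) auto
    finally show ?thesis .
  qed
  have "measure_pmf.prob ?M (- G) \<le> \<epsilon>"
  proof (cases "\<epsilon> \<ge> 1")
    case True
    then show ?thesis using measure_pmf.prob_le_1[of ?M "- G"] by linarith
  next
    case eps_1: False
    have b_pos: "b > 0" using n_pos eps_pos eps_1 by (simp add: b_def)
    have bound: "measure_pmf.prob ?M (- G) \<le> measure_pmf.prob ?M E"
      if "\<And>T y. (T, y) \<in> set_pmf ?M \<Longrightarrow> (T, y) \<notin> G \<Longrightarrow> (T, y) \<in> E" for E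
      using that by (subst measure_Int_set_pmf[symmetric]) (auto intro!: measure_pmf.finite_measure_mono)
    \<comment> \<open>For n from 2 to 7, 2^n is at most n^3, so even reading all variables stays
      within \<open>b\<close>. For n = 1 this can fail, and from 8 on the numeric bound
      applies.\<close>
    consider "real n \<le> b" | "n = 1" "b < 1" | "n \<ge> 8"
    proof (cases "2 \<le> n \<and> n < 8")
      case True
      then have "n \<in> {2, 3, 4, 5, 6, 7}" by auto
      then have "(2 :: real) ^ n \<le> real n ^ 3" by auto
      then have "log 2 (2 ^ n) \<le> log 2 (real n ^ 3)" using n_pos by (subst log_le_cancel_iff) auto
      also have "\<dots> \<le> b"
        using n_pos eps_pos eps_1 by (simp add: b_def log_nat_power field_simps)
      finally show ?thesis using that(1) by (simp add: log_nat_power)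
    qed (use that n_pos in force)
    then show ?thesis
    proof cases
      case 1
      have "real (run_reads T Z (layers j)) \<le> b" if "T \<in> set_pmf D" for T Z j
      proof -
        have "card T \<le> n" using card_mono[OF _ supp(1)[OF that]] by simp
        then show ?thesis using reads_le[OF that, of Z j] 1 by linarith
      qed
      then have "measure_pmf.prob ?M (- G) \<le> measure_pmf.prob ?M {}"
        using set_M(1) good by (intro bound) blast
      then show ?thesis using eps_pos by simp
    next
      case 2
      have "T \<noteq> {}" if "(T, y) \<in> set_pmf ?M" "(T, y) \<notin> G" for T y
        using that good[of T y] reads_le[OF set_M(1)[OF that(1)]] b_pos by fastforce
      then have "(T, y) \<in> {(T, y). {0} \<subseteq> T}" if "(T, y) \<in> set_pmf ?M" "(T, y) \<notin> G" for T y
        using that supp(1)[OF set_M(1)[OF that(1)]] 2(1) by fastforce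
      then have "measure_pmf.prob ?M (- G) \<le> measure_pmf.prob ?M {(T, y). {0} \<subseteq> T}"
        by (rule bound)
      also have "\<dots> = measure_pmf.expectation D (\<lambda>T. of_bool ({0} \<subseteq> T))"
        by (subst prob_restriction_distr[OF fin])
          (auto intro!: arg_cong[where f = "measure_pmf.expectation D"])
      \<comment> \<open>With the empty list and run length 0 the estimate reduces to the marginal of
        the single element 0.\<close>
      also have "\<dots> \<le> 1/2 + \<epsilon> ^ 10"
        using biased_run_prob[OF D _, of "[]" "{0}" False 0] eps_pos 2(1) by simp
      also have "\<dots> \<le> \<epsilon>"
      proof -
        have "log 2 ((1 / \<epsilon>) ^ 3) < 1"
          using 2 eps_pos by (simp add: b_def log_nat_power)
        then have "(1 / \<epsilon>) ^ 3 < 2" using eps_pos by (simp add: log_less_iff)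
        then have "1 / 2 < \<epsilon> ^ 3" using eps_pos by (simp add: field_simps)
        have e1: "79/100 < \<epsilon>"
        proof (rule ccontr)
          assume "\<not> 79/100 < \<epsilon>"
          then have "\<epsilon> ^ 3 \<le> (79/100) ^ 3" using eps_pos by (intro power_mono) auto
          with \<open>1 / 2 < \<epsilon> ^ 3\<close> show False by (simp add: power3_eq_cube)
        qed
        have e2: "\<epsilon> \<le> 9/10" using n_1 2(1) eps_1 by auto
        \<comment> \<open>Here \<epsilon> lies between 0.79 and 0.9. Bounding \<epsilon>^9 by 0.9^9
          throughout would be too weak near 0.79, so the interval is split at 0.85.\<close>
        define q :: real where "q = (if \<epsilon> \<le> 85/100 then 85/100 else 9/10)"
        have "\<epsilon> ^ 9 \<le> q ^ 9" using eps_pos e2 by (intro power_mono) (auto simp: q_def)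
        then have "\<epsilon> * (1 - q ^ 9) \<le> \<epsilon> * (1 - \<epsilon> ^ 9)"
          using eps_pos by (intro mult_left_mono) auto
        moreover have "1/2 \<le> \<epsilon> * (1 - q ^ 9)"
          using e1 by (auto simp: q_def power_numeral_reduce)
        ultimately show ?thesis by (simp add: algebra_simps power_numeral_reduce)
      qed
      finally show ?thesis .
    next
      case 3
      \<comment> \<open>\<open>k\<close> is the least integer above \<open>b\<close>, so a block
        exceeding the bound has at least \<open>k\<close> reads. The window length \<open>L\<close>
        makes (3/4)^L small while 2^L stays of order (n/\<epsilon>)^6, which the bias
        (\<epsilon>/n)^10 outweighs.\<close>
      define k where "k = Suc (nat \<lfloor>b\<rfloor>)"
      define L where "L = nat \<lceil>6 * log 2 (real n / \<epsilon>)\<rceil>"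
      define E where "E j = {(T, y). long_run T {i. y i = c T i}
        (L < length (layers j)) k (take L (layers j))}" for j
      have N8: "8 \<le> real n / \<epsilon>"
        using 3 eps_pos eps_1 by (simp add: field_simps)
      have k: "b < real k" "\<And>r. r < k \<Longrightarrow> real r \<le> b"
        using b_pos unfolding k_def by linarith+
      have L: "6 * log 2 (real n / \<epsilon>) \<le> real L" "real L \<le> 6 * log 2 (real n / \<epsilon>) + 1"
        using b_pos unfolding L_def b_def by linarith+
      let ?\<delta> = "(\<epsilon> / real n) ^ 10"
      have E_le: "measure_pmf.prob ?M (E j) \<le> \<epsilon> / real n" for j
      proof -
        let ?l = "length (take L (layers j))"
        have "measure_pmf.prob ?M (E j) \<le>
            (2/3) ^ k + of_bool (L < length (layers j)) * (3/4) ^ ?l + 2 ^ ?l * ?\<delta>"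
          unfolding E_def using eps_pos c
          by (intro prob_long_run_biased[OF D]) (auto simp: layers_def dest: in_set_takeD)
        also have "\<dots> \<le> (2/3) ^ k + (3/4) ^ L + 2 ^ L * ?\<delta>"
        proof (intro add_mono order_refl)
          \<comment> \<open>Either the window is truncated and has length exactly \<open>L\<close>,
            or the left side is zero.\<close>
          show "of_bool (L < length (layers j)) * (3/4) ^ ?l \<le> (3/4 :: real) ^ L" by simp
          show "2 ^ ?l * ?\<delta> \<le> 2 ^ L * ?\<delta>"
            using eps_pos by (intro mult_right_mono power_increasing) auto
        qed
        also have "\<dots> = (2/3) ^ k + (3/4) ^ L + 2 ^ L / (real n / \<epsilon>) ^ 10"
          by (simp add: power_divide)
        also have "\<dots> \<le> 1 / (real n / \<epsilon>)"
          by (rule numeric_bound) (use N8 L k(1) in \<open>auto simp: b_def\<close>)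
        finally show ?thesis by simp
      qed
      have "(T, y) \<in> (\<Union>j<n. E j)" if y: "(T, y) \<in> set_pmf ?M" "(T, y) \<notin> G" for T y
      proof -
        let ?r = "\<lambda>j. run_reads T {i. y i = c T i} (layers j)"
        obtain j where j: "j \<le> n" "\<not> real (?r j) \<le> b" using good[OF y(1)] y(2) by blast
        \<comment> \<open>No layers remain from n on, so n starting points suffice and the union
          bound gives exactly \<epsilon>.\<close>
        have "j \<noteq> n" using j(2) b_pos by (auto simp: layers_def)
        moreover have "k \<le> ?r j" using k(2) j(2) not_le by blast
        then have "(T, y) \<in> E j" unfolding E_def by (auto intro: run_reads_long_run)
        ultimately show ?thesis using j(1) by auto
      qed
      then have "measure_pmf.prob ?M (- G) \<le> measure_pmf.prob ?M (\<Union>j<n. E j)"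
        by (rule bound)
      also have "\<dots> \<le> (\<Sum>j<n. measure_pmf.prob ?M (E j))"
        by (rule measure_pmf.finite_measure_subadditive_finite) auto
      also have "\<dots> \<le> (\<Sum>j<n. \<epsilon> / real n)" by (intro sum_mono E_le)
      also have "\<dots> = \<epsilon>" using n_pos by simp
      finally show ?thesis .
    qed
  qed
  then have "1 - \<epsilon> \<le> measure_pmf.prob ?M G"
    using measure_pmf.prob_compl[of G ?M] by (simp add: Compl_eq_Diff_UNIV)
  then show "1 - \<epsilon> \<le> measure_pmf.prob ?M
      {(T, y). computed_by_blocks 3 (3 * log 2 (real n / \<epsilon>)) T
         (restrict_fun (bp_eval (BT T)) T y)}"
    by (simp add: G_def b_def)
qed

end
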